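(* Let $\alpha\in[1,2)$, let $A\in\mathbb{R}^{4\times 4}$ have characteristic polynomial $f(\lambda)=\lambda^4+a_1\lambda^3+a_2\lambda^2+a_3\lambda+a_4$, and put $s=\cos^2\left(\frac{\alpha\pi}{2}\right)$. Then the fractional-order system $\mathrm{D}^{\alpha}x=Ax$ is asymptotically stable if and only if the following four inequalities hold: (1) $a_1>0$; (2) $\left(4a_1a_3-4a_2^2\right)s+a_1^2a_2-a_1a_3>0$; (3) $$\begin{aligned} &\left(64a_1a_4^2-128a_2a_3a_4+64a_3^3\right)s^3\\ &-\left(16a_1^2a_3a_4+16a_1a_2^2a_4+16a_1a_2a_3^2-64a_1a_4^2+96a_2a_3a_4-48a_3^3\right)s^2\\ &+\left(4a_1^3a_2a_4-4a_1^3a_3^2+8a_1^2a_3a_4+4a_1a_2^2a_4+4a_1a_2a_3^2-4a_2^3a_3-16a_1a_4^2+16a_2a_3a_4-12a_3^3\right)s\\ &-a_1^3a_2a_4+a_1^2a_2^2a_3+a_1^2a_3a_4-2a_1a_2a_3^2+a_3^3>0; \end{aligned}$$ (4) $$\begin{aligned} a_4\cdot\Big(&4096a_4^3s^6+\left(-1024a_1a_3a_4^2-8192a_4^3\right)s^5\\ &+\left(256a_1^2a_2a_4^2+1536a_1a_3a_4^2-512a_2^2a_4^2+256a_2a_3^2a_4+6144a_4^3\right)s^4\\ &+\left(-64a_1^4a_4^2-64a_1^2a_2a_4^2-64a_1a_2^2a_3a_4-1024a_1a_3a_4^2+512a_2^2a_4^2-64a_2a_3^2a_4-64a_3^4-2048a_4^3\right)s^3\\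 &+\big(48a_1^4a_4^2+16a_1^3a_2a_3a_4-64a_1^2a_2a_4^2-16a_1^2a_3^2a_4-32a_1a_2^2a_3a_4+16a_1a_2a_3^3+16a_2^4a_4\\ &\qquad+384a_1a_3a_4^2-128a_2^2a_4^2-64a_2a_3^2a_4+48a_3^4+256a_4^3\big)s^2\\ &+\big(-12a_1^4a_4^2+4a_1^3a_2a_3a_4-4a_1^3a_3^3-4a_1^2a_2^3a_4+16a_1^2a_2a_4^2+8a_1^2a_3^2a_4+16a_1a_2^2a_3a_4\\ &\qquad+4a_1a_2a_3^3-4a_2^3a_3^2-64a_1a_3a_4^2+16a_2a_3^2a_4-12a_3^4\big)s\\ &+a_1^4a_4^2-2a_1^3a_2a_3a_4+a_1^2a_2^2a_3^2+2a_1^2a_3^2a_4-2a_1a_2a_3^3+a_3^4\Big)>0. \end{aligned}$$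
   Context: The system is the fractional-order linear time-invariant system $\mathrm{D}^{\alpha}x=Ax$ with state vector $x=(x_1,x_2,x_3,x_4)^T$, fractional order $\alpha\in[1,2)$ and real $4\times 4$ matrix $A$. Asymptotic stability is used through the known criterion of Matignon: the system is asymptotically stable if and only if every eigenvalue $\lambda_j$ of $A$ satisfies $|\arg(\lambda_j)|>\frac{\alpha\pi}{2}$, where $\arg$ denotes the argument of a complex number.
   Formalization: Inequality (3) as printed is false (A=-I, α=3/2 is stable but gives -2592); two signs are corrected: the whole s^3 term is negated, and 16a_1a_2a_3^2 inside the s^2 bracket has a minus sign. Asymptotic stability is taken as Matignon's eigenvalue condition. *)

theory Defs
  imports "HOL-Analysis.Analysis" "Jordan_Normal_Form.Char_Poly"
begin

(* Asymptotic stability of the fractional-order linear system D^alpha x = A x, in the form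
   in which it is used: Matignon's criterion on the arguments of the (complex) eigenvalues.
   Arg takes values in (-pi, pi], and Arg 0 = 0, so a singular A is never stable. *)
definition asymptotically_stable :: "real \<Rightarrow> real mat \<Rightarrow> bool" where
  "asymptotically_stable \<alpha> A \<longleftrightarrow>
     (\<forall>z. eigenvalue (map_mat complex_of_real A) z \<longrightarrow> \<bar>Arg z\<bar> > \<alpha> * pi / 2)"

(* The third inequality of the source has two misprinted signs: that of the whole s^3 term
   and that of 16 a1 a2 a3^2 inside the s^2 coefficient.  The name source_ineq3 is the printed
   left-hand side.  It is negative for A = -I (characteristic polynomial (x+1)^4) and
   alpha = 3/2 (so s = 1/2), although this system is asymptotically stable; see the two lemmas.
   With both signs corrected, the k-th expression (k = 1, 2, 3, 4) times sin(alpha pi/2)^k is,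
   up to the sign convention of the rows, the 2k x 2k leading Hurwitz minor of the
   characteristic polynomial rotated by the angle (alpha - 1) pi/2. *)
definition source_ineq3 :: "real \<Rightarrow> real \<Rightarrow> real \<Rightarrow> real \<Rightarrow> real \<Rightarrow> real" where
  "source_ineq3 a1 a2 a3 a4 s =
     (64*a1*a4^2 - 128*a2*a3*a4 + 64*a3^3) * s^3
   - (16*a1^2*a3*a4 + 16*a1*a2^2*a4 + 16*a1*a2*a3^2 - 64*a1*a4^2 + 96*a2*a3*a4 - 48*a3^3) * s^2
   + (4*a1^3*a2*a4 - 4*a1^3*a3^2 + 8*a1^2*a3*a4 + 4*a1*a2^2*a4 + 4*a1*a2*a3^2 - 4*a2^3*a3
      - 16*a1*a4^2 + 16*a2*a3*a4 - 12*a3^3) * s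
   - a1^3*a2*a4 + a1^2*a2^2*a3 + a1^2*a3*a4 - 2*a1*a2*a3^2 + a3^3"

lemma source_ineq3_fails:
  "char_poly (- 1\<^sub>m 4 :: real mat) = [:1, 4, 6, 4, 1:]"
  "(cos (3 / 2 * pi / 2))\<^sup>2 = (1 / 2 :: real)"
  "source_ineq3 4 6 4 1 (1 / 2) < 0"
proof -
  have "char_poly (- 1\<^sub>m 4 :: real mat) = (\<Prod>a\<leftarrow>diag_mat (- 1\<^sub>m 4 :: real mat). [:- a, 1:])"
    by (rule char_poly_upper_triangular[of _ 4]) (auto simp: upper_triangular_def)
  also have "diag_mat (- 1\<^sub>m 4 :: real mat) = [-1, -1, -1, -1]"
    by (simp add: diag_mat_def upt_rec numeral_eq_Suc)
  finally show "char_poly (- 1\<^sub>m 4 :: real mat) = [:1, 4, 6, 4, 1:]"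
    by simp
  have "cos (3 / 2 * pi / 2) = cos (pi - pi / 4)"
    by (rule arg_cong[where f = cos]) simp
  also have "\<dots> = - (sqrt 2 / 2)"
    by (simp only: cos_pi_minus cos_45)
  finally show "(cos (3 / 2 * pi / 2))\<^sup>2 = (1 / 2 :: real)"
    by (simp add: power_divide)
  show "source_ineq3 4 6 4 1 (1 / 2) < 0"
    by (simp add: source_ineq3_def power_divide)
qed

lemma asymptotically_stable_uminus_one: "asymptotically_stable (3 / 2) (- 1\<^sub>m 4)"
  unfolding asymptotically_stable_def
proof (intro allI impI)
  fix z assume "eigenvalue (map_mat complex_of_real (- 1\<^sub>m 4)) z"
  then obtain v where v: "v \<in> carrier_vec 4" "v \<noteq> 0\<^sub>v 4"
    and ev: "map_mat complex_of_real (- 1\<^sub>m 4) *\<^sub>v v = z \<cdot>\<^sub>v v"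
    by (auto simp: eigenvalue_def eigenvector_def)
  have "map_mat complex_of_real (- 1\<^sub>m 4) = - 1\<^sub>m 4"
    by (rule eq_matI) auto
  with ev v have eq: "- v = z \<cdot>\<^sub>v v"
    by (metis one_carrier_mat one_mult_mat_vec uminus_mult_mat_vec carrier_vecD index_one_mat(3))
  from v obtain i where i: "i < 4" "v $ i \<noteq> 0"
    by (metis carrier_vecD eq_vecI index_zero_vec)
  have "(- v) $ i = (z \<cdot>\<^sub>v v) $ i" using eq by simp
  hence "- (v $ i) = z * v $ i" using i v by simp
  hence "z = -1" using i(2) by (metis mult_cancel_right mult_minus1)
  thus "\<bar>Arg z\<bar> > 3 / 2 * pi / 2" by (simp add: Arg_minus)
qed

end

theory Submission
  imports Defs
begin

text \<open>Put \<open>\<phi> = \<alpha> * pi / 2\<close>. Since \<open>\<phi> \<ge> pi / 2\<close>, the sector \<open>\<bar>Arg z\<bar> > \<phi>\<close> is the intersection of the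
  half plane \<open>Im (z * cis (- \<phi>)) > 0\<close> with its complex conjugate, and the roots of a real
  polynomial \<open>f\<close> are closed under conjugation. So stability means that all roots of the rotated
  polynomial \<open>h p = f (cis \<phi> * p)\<close> lie in the upper half plane. By Hermite's theorem this holds iff
  the Bezoutian \<open>(h x * h\<^sup>* y - h\<^sup>* x * h y) / (x - y)\<close>, where \<open>h\<^sup>* x = cnj (h (cnj x))\<close>, is
  positive definite up to the factor \<open>2 * \<i>\<close>. For the rotation of a real quartic the matrix is
  \<open>sin \<phi>\<close> times a real one whose entries are polynomials in \<open>cos \<phi>\<close>, and its four leading minors,
  counted from the highest power, are the four expressions of the theorem.\<close>

section \<open>Polynomials that vanish off a point or off the diagonal\<close>

text \<open>Kernel identities carry a factor \<open>x - y\<close>, which cancels only for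
  \<open>x \<noteq> y\<close>. One excluded point still leaves infinitely many zeros, so the
  polynomial is zero.\<close>

lemma coeff_zero_if_vanishes_off_point:
  fixes c :: "nat \<Rightarrow> complex"
  assumes "\<And>x. x \<noteq> a \<Longrightarrow> (\<Sum>i<n. c i * x ^ i) = 0" and "i < n"
  shows "c i = 0"
proof -
  define p where "p = (\<Sum>i<n. monom (c i) i)"
  have eval: "poly p x = (\<Sum>i<n. c i * x ^ i)" for x
    by (simp add: p_def poly_sum poly_monom)
  have "UNIV - {a} \<subseteq> {x. poly p x = 0}"
    using assms(1) by (auto simp: eval)
  moreover have "infinite (UNIV - {a} :: complex set)"
    by (simp add: infinite_UNIV_char_0)
  ultimately have "p = 0"
    using finite_subset poly_roots_finite by blast
  moreover have "coeff p i = c i"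
    using assms(2) by (simp add: p_def coeff_sum)
  ultimately show ?thesis by simp
qed

text \<open>Freeze \<open>y\<close>: each coefficient of \<open>x ^ i\<close> is a polynomial in
  \<open>y\<close> that vanishes for every \<open>y\<close>, so its own coefficients vanish
  too.\<close>

lemma coeff_zero_if_vanishes_off_diagonal:
  fixes C :: "nat \<Rightarrow> nat \<Rightarrow> complex"
  assumes "\<And>x y. x \<noteq> y \<Longrightarrow> (\<Sum>i<n. \<Sum>j<n. C i j * x ^ i * y ^ j) = 0"
    and "i < n" and "j < n"
  shows "C i j = 0"
proof -
  have "(\<Sum>j<n. C i j * y ^ j) = 0" for y
  proof (rule coeff_zero_if_vanishes_off_point[where a = y and i = i and n = n])
    fix x assume "x \<noteq> y"
    from assms(1)[OF this] show "(\<Sum>i<n. (\<Sum>j<n. C i j * y ^ j) * x ^ i) = 0"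
      by (simp add: sum_distrib_left sum_distrib_right mult_ac)
  qed (fact assms(2))
  then show ?thesis
    using coeff_zero_if_vanishes_off_point[where c = "C i" and n = n and i = j] assms(3) by blast
qed

section \<open>Hermite's diagonalisation of the Bezoutian\<close>

abbreviation root_prod :: "complex list \<Rightarrow> complex poly" where
  "root_prod rs \<equiv> (\<Prod>r\<leftarrow>rs. [:- r, 1:])"

text \<open>In closed form, entry \<open>k\<close> is the product of the factors
  \<open>x - rs ! j\<close> over \<open>j < k\<close> and \<open>x - cnj (rs ! j)\<close> over
  \<open>j > k\<close>. In these polynomials the Bezoutian becomes diagonal.\<close>

fun hermite_basis :: "complex list \<Rightarrow> complex poly list" where
  "hermite_basis [] = []"
| "hermite_basis (r # rs) =
     root_prod (map cnj rs) # map ((*) [:- r, 1:]) (hermite_basis rs)"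

lemma length_hermite_basis [simp]: "length (hermite_basis rs) = length rs"
  by (induction rs) auto

lemma degree_root_prod: "degree (root_prod rs) = length rs"
  by (simp add: degree_linear_factors)

lemma poly_root_prod_cnj: "poly (root_prod (map cnj rs)) x = cnj (poly (root_prod rs) (cnj x))"
  by (induction rs) auto

lemma degree_hermite_basis: "P \<in> set (hermite_basis rs) \<Longrightarrow> degree P < length rs"
proof (induction rs arbitrary: P)
  case (Cons r rs)
  show ?case
  proof (cases "P = root_prod (map cnj rs)")
    case True
    then show ?thesis using degree_root_prod[of "map cnj rs"] by simp
  next
    case False
    then obtain Q where "Q \<in> set (hermite_basis rs)" "P = [:- r, 1:] * Q"
      using Cons.prems by auto
    with Cons.IH[of Q] degree_mult_le[of "[:- r, 1:]" Q] show ?thesis by simp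
  qed
qed simp

text \<open>A new root \<open>r\<close> multiplies the old difference by
  \<open>(x - r) * (y - cnj r)\<close> and adds a rank-one term with the factor
  \<open>(x - y) * (r - cnj r)\<close>. Since \<open>r - cnj r = 2 * \<i> * Im r\<close>, the added
  term is the head of the new basis with weight \<open>Im r\<close>; the multiplied part matches the
  tail, whose entries all gain the factor \<open>x - r\<close>.\<close>

lemma hermite_decomposition:
  "poly (root_prod rs) x * cnj (poly (root_prod rs) (cnj y))
     - cnj (poly (root_prod rs) (cnj x)) * poly (root_prod rs) y
   = 2 * \<i> * (x - y) * (\<Sum>k<length rs. Im (rs ! k) * poly (hermite_basis rs ! k) x
       * cnj (poly (hermite_basis rs ! k) (cnj y)))"
proof (induction rs)
  case (Cons r rs)
  let ?f = "\<lambda>x. poly (root_prod rs) x" and ?g = "\<lambda>x. cnj (poly (root_prod rs) (cnj x))"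
  let ?S = "\<Sum>k<length rs. Im (rs ! k) * poly (hermite_basis rs ! k) x
       * cnj (poly (hermite_basis rs ! k) (cnj y))"
  have factor: "poly (root_prod (r # rs)) z = (z - r) * ?f z" for z
    by (simp add: algebra_simps)
  have im: "2 * \<i> * Im r = r - cnj r"
    by (simp add: complex_eq_iff)
  have sum: "(\<Sum>k<length (r # rs). Im ((r # rs) ! k) * poly (hermite_basis (r # rs) ! k) x
       * cnj (poly (hermite_basis (r # rs) ! k) (cnj y)))
     = Im r * ?g x * ?f y + (x - r) * (y - cnj r) * ?S"
    by (simp add: sum.lessThan_Suc_shift poly_root_prod_cnj sum_distrib_left algebra_simps
             del: sum.lessThan_Suc map_map)
  have "(x - r) * ?f x * ((y - cnj r) * ?g y) - (x - cnj r) * ?g x * ((y - r) * ?f y)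
     = (x - r) * (y - cnj r) * (?f x * ?g y - ?g x * ?f y)
       + (x - y) * (r - cnj r) * (?g x * ?f y)"
    by (simp add: algebra_simps)
  also have "\<dots> = 2 * \<i> * (x - y) * (Im r * ?g x * ?f y + (x - r) * (y - cnj r) * ?S)"
    unfolding Cons.IH im[symmetric] by (simp add: algebra_simps)
  finally show ?case
    by (simp only: sum factor complex_cnj_mult complex_cnj_diff complex_cnj_cnj)
qed simp

text \<open>The product over \<open>cnj rs\<close> does not vanish at \<open>r\<close>, so modulo a multiple of it every \<open>Q\<close> is
  divisible by \<open>[:- r, 1:]\<close>, and the quotient has smaller degree.\<close>

lemma hermite_basis_spans:
  fixes L :: "complex poly \<Rightarrow> complex"
  assumes "\<And>r. r \<in> set rs \<Longrightarrow> Im r > 0"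
    and "\<And>P Q. L (P + Q) = L P + L Q" and "\<And>c P. L (Polynomial.smult c P) = c * L P"
    and "\<And>P. P \<in> set (hermite_basis rs) \<Longrightarrow> L P = 0"
    and "degree Q < length rs"
  shows "L Q = 0"
  using assms
proof (induction rs arbitrary: L Q)
  case (Cons r rs)
  let ?h = "root_prod (map cnj rs)"
  have "poly (root_prod rs) (cnj r) \<noteq> 0"
  proof
    assume "poly (root_prod rs) (cnj r) = 0"
    then have "cnj r \<in> set rs" 
      by (induction rs) auto
    then show False
      using Cons.prems(1)[of r] Cons.prems(1)[of "cnj r"] by simp
  qed
  then have hr: "poly ?h r \<noteq> 0" by (simp only: poly_root_prod_cnj complex_cnj_zero_iff not_False_eq_True)
  define c where "c = poly Q r / poly ?h r"
  have "poly (Q - Polynomial.smult c ?h) r = 0" using hr by (simp add: c_def)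
  then obtain S where S: "Q - Polynomial.smult c ?h = [:- r, 1:] * S"
    by (metis dvdE poly_eq_0_iff_dvd)
  have L0: "L ([:- r, 1:] * S) = 0"
  proof (cases "S = 0")
    case True
    then show ?thesis using Cons.prems(3)[of 0 0] by simp
  next
    case False
    have "degree (Q - Polynomial.smult c ?h) \<le> length rs"
      using Cons.prems(5) degree_root_prod[of "map cnj rs"] degree_smult_le[of c ?h]
      by (intro degree_diff_le) auto
    with False have deg: "degree S < length rs"
      unfolding S by (subst (asm) degree_mult_eq) auto
    \<comment> \<open>The induction hypothesis is applied to the functional that first multiplies by
      \<open>[:- r, 1:]\<close>. It kills the basis of \<open>rs\<close> because these products form
      the tail of the longer basis.\<close>
    show ?thesis
    proof (rule Cons.IH[where L = "\<lambda>P. L ([:- r, 1:] * P)"])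
      show "L ([:- r, 1:] * (P + R)) = L ([:- r, 1:] * P) + L ([:- r, 1:] * R)" for P R
        by (metis Cons.prems(2) distrib_left)
      show "L ([:- r, 1:] * Polynomial.smult d P) = d * L ([:- r, 1:] * P)" for d P
        by (metis Cons.prems(3) mult_smult_right)
      show "L ([:- r, 1:] * P) = 0" if "P \<in> set (hermite_basis rs)" for P
        using Cons.prems(4) that by simp
    qed (use Cons.prems(1) deg in auto)
  qed
  have "Q = Polynomial.smult c ?h + [:- r, 1:] * S"
    using S by (simp add: algebra_simps)
  moreover have "L ?h = 0" using Cons.prems(4) by simp
  ultimately show ?case
    using L0 Cons.prems(2,3) by (metis add.right_neutral mult_zero_right)
qed simp

section \<open>Hermite's criterion for roots in the upper half plane\<close>

text \<open>Serves twice below: with powers of \<open>x\<close> and \<open>y\<close> for the kernel,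
  and with a vector and its conjugate for the form.\<close>

lemma sum_rank_one:
  fixes d :: "'a \<Rightarrow> 'b::comm_semiring_0"
  shows "(\<Sum>k\<in>K. d k * (\<Sum>i\<in>I. e k i * u i) * (\<Sum>j\<in>J. g k j * w j))
    = (\<Sum>i\<in>I. \<Sum>j\<in>J. (\<Sum>k\<in>K. d k * e k i * g k j) * u i * w j)"
proof -
  let ?T = "\<lambda>k i j. d k * e k i * g k j * u i * w j"
  have "(\<Sum>k\<in>K. d k * (\<Sum>i\<in>I. e k i * u i) * (\<Sum>j\<in>J. g k j * w j))
      = (\<Sum>k\<in>K. \<Sum>i\<in>I. \<Sum>j\<in>J. ?T k i j)"
    by (simp only: mult.assoc sum_product) (simp add: sum_distrib_left mult_ac)
  also have "\<dots> = (\<Sum>i\<in>I. \<Sum>k\<in>K. \<Sum>j\<in>J. ?T k i j)"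
    by (rule sum.swap)
  also have "\<dots> = (\<Sum>i\<in>I. \<Sum>j\<in>J. \<Sum>k\<in>K. ?T k i j)"
    by (intro sum.cong refl sum.swap)
  finally show ?thesis
    by (simp only: sum_distrib_right)
qed

text \<open>If the form is positive, testing it on the powers of a root forces the imaginary part of
  that root to be positive. If all roots lie in the upper half plane, the kernel determines
  \<open>M\<close>, and the diagonalisation turns the form into a sum of squared moduli with weights
  \<open>Im r > 0\<close>, which cannot all vanish because the basis spans.\<close>

theorem hermite_criterion:
  fixes h :: "complex poly" and M :: "nat \<Rightarrow> nat \<Rightarrow> complex"
  assumes kernel: "\<And>x y. poly h x * cnj (poly h (cnj y)) - cnj (poly h (cnj x)) * poly h y
      = 2 * \<i> * (x - y) * (\<Sum>i<degree h. \<Sum>j<degree h. M i j * x ^ i * y ^ j)"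
    and "h \<noteq> 0"
  shows "(\<forall>z. poly h z = 0 \<longrightarrow> Im z > 0) \<longleftrightarrow>
    (\<forall>v. (\<exists>i<degree h. v i \<noteq> 0) \<longrightarrow>
      Re (\<Sum>i<degree h. \<Sum>j<degree h. M i j * v i * cnj (v j)) > 0)"
    (is "?stable \<longleftrightarrow> ?pd")
proof
  define n where "n = degree h"
  define B where "B x y = (\<Sum>i<n. \<Sum>j<n. M i j * x ^ i * y ^ j)" for x y
  note kernel' = kernel[folded n_def, folded B_def]
  assume pd: ?pd
  show ?stable
  proof (intro allI impI)
    fix z assume root: "poly h z = 0"
    have "n > 0"
    proof (rule ccontr)
      assume "\<not> n > 0"
      then obtain a where "h = [:a:]"
        unfolding n_def using degree_eq_zeroE by blast
      with root \<open>h \<noteq> 0\<close> show False by simp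
    qed
    \<comment> \<open>The power \<open>z ^ 0\<close> is 1 even for \<open>z = 0\<close>, so the test
      vector is nonzero.\<close>
    then have "\<exists>i<n. z ^ i \<noteq> 0"
      by (intro exI[of _ 0]) simp
    then have pos: "Re (B z (cnj z)) > 0"
      using pd[folded n_def, rule_format, of "\<lambda>i. z ^ i"] by (simp only: B_def complex_cnj_power)
    \<comment> \<open>At the pair \<open>z\<close>, \<open>cnj z\<close> the first product of the
      kernel contains \<open>poly h z = 0\<close>, and the second is the squared modulus of
      \<open>h\<close> at \<open>cnj z\<close>.\<close>
    have "- (poly h (cnj z) * cnj (poly h (cnj z))) = 2 * \<i> * (z - cnj z) * B z (cnj z)"
      using kernel'[of z "cnj z"] root by (simp add: mult.commute)
    also have "2 * \<i> * (z - cnj z) = - of_real (4 * Im z)"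
      by (simp add: complex_eq_iff)
    finally have "of_real ((cmod (poly h (cnj z)))\<^sup>2) = of_real (4 * Im z) * B z (cnj z)"
      by (simp add: complex_norm_square del: of_real_power)
    from arg_cong[OF this, of Re]
    have eq: "(cmod (poly h (cnj z)))\<^sup>2 = 4 * Im z * Re (B z (cnj z))"
      by (simp only: Re_complex_of_real times_complex.sel Im_complex_of_real mult_zero_left diff_zero)
    \<comment> \<open>For real \<open>z\<close> the kernel identity at \<open>(z, z)\<close> only
      says \<open>0 = 0\<close>. Instead \<open>B z y\<close> vanishes for all
      \<open>y \<noteq> z\<close>, hence so do its coefficients in \<open>y\<close>, and thus its
      value at \<open>y = z\<close>.\<close>
    have "Im z \<noteq> 0"
    proof
      assume "Im z = 0"
      then have real: "cnj z = z" by (simp add: complex_eq_iff)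
      have "(\<Sum>i<n. M i j * z ^ i) = 0" if "j < n" for j
      proof (rule coeff_zero_if_vanishes_off_point[where a = z and n = n and i = j])
        fix y assume "y \<noteq> z"
        with kernel'[of z y] root real have "B z y = 0" by simp
        then show "(\<Sum>j<n. (\<Sum>i<n. M i j * z ^ i) * y ^ j) = 0"
          unfolding B_def by (subst (asm) sum.swap) (simp add: sum_distrib_right)
      qed fact
      moreover have "B z (cnj z) = (\<Sum>j<n. (\<Sum>i<n. M i j * z ^ i) * cnj z ^ j)"
        unfolding B_def by (subst sum.swap) (simp add: sum_distrib_right)
      ultimately have "B z (cnj z) = 0" by simp
      with pos show False by simp
    qed
    moreover have "Im z \<ge> 0"
      using eq pos zero_le_power2[of "cmod (poly h (cnj z))"] by (simp add: zero_le_mult_iff)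
    ultimately show "Im z > 0" by simp
  qed
next
  define n where "n = degree h"
  assume stable: ?stable
  obtain rs where h: "h = Polynomial.smult (lead_coeff h) (root_prod rs)" and len: "length rs = n"
    using fundamental_theorem_algebra_factorized[of h] unfolding n_def by metis
  define c where "c = lead_coeff h"
  have "c \<noteq> 0" using \<open>h \<noteq> 0\<close> by (simp add: c_def)
  have rs: "Im r > 0" if "r \<in> set rs" for r
  proof -
    have "poly (root_prod rs) r = 0"
      using that by (induction rs) auto
    then have "poly h r = 0" by (subst h) simp
    with stable show ?thesis by blast
  qed
  define P where "P k = hermite_basis rs ! k" for k
  have deg: "degree (P k) < n" if "k < n" for k
    using degree_hermite_basis[of "P k" rs] that len by (simp add: P_def)
  have poly_P: "poly (P k) x = (\<Sum>i<n. coeff (P k) i * x ^ i)" if "k < n" for k x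
    unfolding poly_altdef using deg[OF that]
    by (intro sum.mono_neutral_left) (auto simp: coeff_eq_0)
  define E where "E i j = (\<Sum>k<n. Im (rs ! k) * coeff (P k) i * cnj (coeff (P k) j))" for i j
  \<comment> \<open>Uniqueness of the kernel coefficients: after cancelling \<open>x - y\<close>,
    both double sums agree off the diagonal.\<close>
  have M: "M i j = c * cnj c * E i j" if "i < n" "j < n" for i j
  proof -
    have "M i j - c * cnj c * E i j = 0"
    proof (rule coeff_zero_if_vanishes_off_diagonal[OF _ that])
      fix x y :: complex assume "x \<noteq> y"
      have ev: "poly h z = c * poly (root_prod rs) z" for z
        by (subst h) (simp add: c_def)
      have E: "(\<Sum>k<n. Im (rs ! k) * poly (P k) x * cnj (poly (P k) (cnj y)))
          = (\<Sum>i<n. \<Sum>j<n. E i j * x ^ i * y ^ j)"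
        unfolding E_def sum_rank_one[symmetric]
        by (intro sum.cong refl) (simp add: poly_P)
      have "2 * \<i> * (x - y) * (\<Sum>i<n. \<Sum>j<n. M i j * x ^ i * y ^ j)
          = c * cnj c * (poly (root_prod rs) x * cnj (poly (root_prod rs) (cnj y))
              - cnj (poly (root_prod rs) (cnj x)) * poly (root_prod rs) y)"
        unfolding n_def kernel[symmetric] by (simp add: ev algebra_simps)
      also have "\<dots> = 2 * \<i> * (x - y) * (c * cnj c * (\<Sum>i<n. \<Sum>j<n. E i j * x ^ i * y ^ j))"
        unfolding hermite_decomposition len E[unfolded P_def] by (simp add: mult_ac)
      finally have "(\<Sum>i<n. \<Sum>j<n. M i j * x ^ i * y ^ j)
          = c * cnj c * (\<Sum>i<n. \<Sum>j<n. E i j * x ^ i * y ^ j)"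
        using \<open>x \<noteq> y\<close> by simp
      then show "(\<Sum>i<n. \<Sum>j<n. (M i j - c * cnj c * E i j) * x ^ i * y ^ j) = 0"
        by (simp add: left_diff_distrib sum_subtractf sum_distrib_left mult.assoc)
    qed
    then show ?thesis by simp
  qed
  show ?pd unfolding n_def[symmetric]
  proof (intro allI impI)
    fix v :: "nat \<Rightarrow> complex"
    assume "\<exists>i<n. v i \<noteq> 0"
    then obtain i where i: "i < n" "v i \<noteq> 0" by blast
    \<comment> \<open>\<open>L\<close> is the linear functional sending the monomial of degree
      \<open>i\<close> to \<open>v i\<close>. If it killed the whole basis, it would kill every
      monomial of degree below \<open>n\<close>, contradicting
      \<open>v i \<noteq> 0\<close>.\<close>
    define L where "L Q = (\<Sum>i<n. coeff Q i * v i)" for Q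
    have "\<exists>k<n. L (P k) \<noteq> 0"
    proof (rule ccontr)
      assume "\<not> (\<exists>k<n. L (P k) \<noteq> 0)"
      then have vanish: "L Q = 0" if "Q \<in> set (hermite_basis rs)" for Q
        using that len by (auto simp: in_set_conv_nth P_def)
      have "L (monom 1 i) = 0"
      proof (rule hermite_basis_spans[of rs L])
        show "L (Q + R) = L Q + L R" for Q R
          by (simp add: L_def distrib_right sum.distrib)
        show "L (Polynomial.smult a Q) = a * L Q" for a Q
          by (simp add: L_def sum_distrib_left mult.assoc)
        show "degree (monom (1 :: complex) i) < length rs"
          using i len by (simp add: degree_monom_eq)
      qed (use rs vanish in auto)
      with i show False
        by (simp add: L_def if_distrib[of "\<lambda>x. x * _"] sum.delta cong: if_cong)
    qed
    then obtain k where k: "k < n" "L (P k) \<noteq> 0" by blast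
    have "(\<Sum>i<n. \<Sum>j<n. M i j * v i * cnj (v j))
        = c * cnj c * (\<Sum>k<n. Im (rs ! k) * L (P k) * cnj (L (P k)))"
    proof -
      have "(\<Sum>i<n. \<Sum>j<n. M i j * v i * cnj (v j))
          = c * cnj c * (\<Sum>i<n. \<Sum>j<n. E i j * v i * cnj (v j))"
        by (simp add: M sum_distrib_left mult.assoc)
      then show ?thesis
        by (simp add: L_def E_def sum_rank_one)
    qed
    also have "\<dots> = of_real ((cmod c)\<^sup>2 * (\<Sum>k<n. Im (rs ! k) * (cmod (L (P k)))\<^sup>2))"
      by (simp only: of_real_mult of_real_sum complex_norm_square mult.assoc)
    finally have "Re (\<Sum>i<n. \<Sum>j<n. M i j * v i * cnj (v j))
        = (cmod c)\<^sup>2 * (\<Sum>k<n. Im (rs ! k) * (cmod (L (P k)))\<^sup>2)"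
      by (metis Re_complex_of_real)
    moreover have "(\<Sum>k<n. Im (rs ! k) * (cmod (L (P k)))\<^sup>2) > 0"
      using k rs len by (intro sum_pos2[of _ k]) (simp_all add: less_imp_le)
    ultimately show "Re (\<Sum>i<n. \<Sum>j<n. M i j * v i * cnj (v j)) > 0"
      using \<open>c \<noteq> 0\<close> by simp
  qed
qed

section \<open>Sylvester's criterion up to four variables\<close>

text \<open>Completing the square: \<open>a\<close> times the form is
  \<open>(a * x + l y)\<^sup>2 + (a * q y - (l y)\<^sup>2)\<close>, and the square vanishes at
  \<open>x = - l y / a\<close>. The type of \<open>y\<close> is left general so that a tuple of the
  remaining variables fits.\<close>

lemma pos_def_schur:
  fixes l q :: "'a::zero \<Rightarrow> real"
  assumes "l 0 = 0" and "q 0 = 0"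
  shows "(\<forall>x y. x \<noteq> 0 \<or> y \<noteq> 0 \<longrightarrow> a * x\<^sup>2 + 2 * x * l y + q y > 0)
    \<longleftrightarrow> a > 0 \<and> (\<forall>y. y \<noteq> 0 \<longrightarrow> a * q y - (l y)\<^sup>2 > 0)" (is "?P \<longleftrightarrow> ?Q")
proof
  assume P: ?P
  from P[rule_format, of 1 0] assms have a: "a > 0" by simp
  have "a * q y - (l y)\<^sup>2 > 0" if "y \<noteq> 0" for y
  proof -
    have "0 < a * (a * (- l y / a)\<^sup>2 + 2 * (- l y / a) * l y + q y)"
      using P[rule_format, of "- l y / a" y] that a by simp
    also have "\<dots> = a * q y - (l y)\<^sup>2"
      using a by (simp add: field_simps power2_eq_square)
    finally show ?thesis .
  qed
  with a show ?Q by blast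
next
  assume Q: ?Q
  show ?P
  proof (intro allI impI)
    fix x :: real and y :: 'a
    assume xy: "x \<noteq> 0 \<or> y \<noteq> 0"
    show "a * x\<^sup>2 + 2 * x * l y + q y > 0"
    proof (cases "y = 0")
      case True
      then show ?thesis using xy Q assms by simp
    next
      case False
      then have "0 < (a * x + l y)\<^sup>2 + (a * q y - (l y)\<^sup>2)"
        using Q by (simp add: add_nonneg_pos)
      also have "\<dots> = a * (a * x\<^sup>2 + 2 * x * l y + q y)"
        by (simp add: algebra_simps power2_eq_square)
      finally show ?thesis using Q by (simp add: zero_less_mult_iff)
    qed
  qed
qed

lemma pos_def_form_2:
  fixes a b d :: real
  shows "(\<forall>x y. x \<noteq> 0 \<or> y \<noteq> 0 \<longrightarrow> a * x\<^sup>2 + 2 * x * (b * y) + d * y\<^sup>2 > 0)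
    \<longleftrightarrow> a > 0 \<and> a * d - b\<^sup>2 > 0"
proof -
  have "(\<forall>y. y \<noteq> 0 \<longrightarrow> a * (d * y\<^sup>2) - (b * y)\<^sup>2 > 0) \<longleftrightarrow> a * d - b\<^sup>2 > 0"
  proof -
    have eq: "a * (d * y\<^sup>2) - (b * y)\<^sup>2 = (a * d - b\<^sup>2) * y\<^sup>2" for y
      by (simp add: algebra_simps power2_eq_square)
    show ?thesis unfolding eq by (auto simp: zero_less_mult_iff dest: spec[of _ 1])
  qed
  with pos_def_schur[of "\<lambda>y. b * y" "\<lambda>y. d * y\<^sup>2" a] show ?thesis by simp
qed

text \<open>Eliminating \<open>x\<close> leaves a binary form whose leading minors are
  \<open>a * d - b\<^sup>2\<close> and, by Sylvester's determinant identity, \<open>a\<close> times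
  the full determinant; \<open>a > 0\<close> then cancels.\<close>

lemma pos_def_form_3:
  fixes a b c d e f :: real
  shows "(\<forall>x y z. x \<noteq> 0 \<or> y \<noteq> 0 \<or> z \<noteq> 0 \<longrightarrow>
      a * x\<^sup>2 + 2 * x * (b * y + c * z) + (d * y\<^sup>2 + 2 * y * (e * z) + f * z\<^sup>2) > 0)
    \<longleftrightarrow> a > 0 \<and> a * d - b\<^sup>2 > 0
      \<and> a * d * f + 2 * b * c * e - a * e\<^sup>2 - d * c\<^sup>2 - f * b\<^sup>2 > 0" (is "?L \<longleftrightarrow> ?R")
proof -
  let ?det = "a * d * f + 2 * b * c * e - a * e\<^sup>2 - d * c\<^sup>2 - f * b\<^sup>2"
  let ?l = "\<lambda>(y, z). b * y + c * z" and ?q = "\<lambda>(y, z). d * y\<^sup>2 + 2 * y * (e * z) + f * z\<^sup>2"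
  have eq: "a * (d * y\<^sup>2 + 2 * y * (e * z) + f * z\<^sup>2) - (b * y + c * z)\<^sup>2
      = (a * d - b\<^sup>2) * y\<^sup>2 + 2 * y * ((a * e - b * c) * z) + (a * f - c\<^sup>2) * z\<^sup>2" for y z
    by (simp add: algebra_simps power2_eq_square)
  have det: "(a * d - b\<^sup>2) * (a * f - c\<^sup>2) - (a * e - b * c)\<^sup>2 = a * ?det"
    by (simp add: algebra_simps power2_eq_square)
  have "?L \<longleftrightarrow> (\<forall>x v. x \<noteq> 0 \<or> v \<noteq> 0 \<longrightarrow> a * x\<^sup>2 + 2 * x * ?l v + ?q v > 0)"
    by (auto simp: zero_prod_def)
  also have "\<dots> \<longleftrightarrow> a > 0 \<and> (\<forall>v. v \<noteq> 0 \<longrightarrow> a * ?q v - (?l v)\<^sup>2 > 0)"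
    by (rule pos_def_schur) (simp_all add: zero_prod_def)
  also have "\<dots> \<longleftrightarrow> a > 0 \<and> (\<forall>y z. y \<noteq> 0 \<or> z \<noteq> 0 \<longrightarrow>
      (a * d - b\<^sup>2) * y\<^sup>2 + 2 * y * ((a * e - b * c) * z) + (a * f - c\<^sup>2) * z\<^sup>2 > 0)"
    by (auto simp: zero_prod_def simp flip: eq)
  also have "\<dots> \<longleftrightarrow> ?R"
    unfolding pos_def_form_2 det by (auto simp: zero_less_mult_iff)
  finally show ?thesis .
qed

lemma pos_def_form_4:
  fixes a b c d e f g h k m :: real
  shows "(\<forall>x y z t. x \<noteq> 0 \<or> y \<noteq> 0 \<or> z \<noteq> 0 \<or> t \<noteq> 0 \<longrightarrow>
      a * x\<^sup>2 + 2 * x * (b * y + c * z + d * t)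
      + (e * y\<^sup>2 + 2 * y * (f * z + g * t) + (h * z\<^sup>2 + 2 * z * (k * t) + m * t\<^sup>2)) > 0)
    \<longleftrightarrow> a > 0 \<and> a * e - b\<^sup>2 > 0
      \<and> a * e * h + 2 * b * c * f - a * f\<^sup>2 - e * c\<^sup>2 - h * b\<^sup>2 > 0
      \<and> m * (a * e * h + 2 * b * c * f - a * f\<^sup>2 - e * c\<^sup>2 - h * b\<^sup>2)
        - k\<^sup>2 * (a * e - b\<^sup>2) - g\<^sup>2 * (a * h - c\<^sup>2) - d\<^sup>2 * (e * h - f\<^sup>2)
        + 2 * k * g * (a * f - b * c) - 2 * k * d * (b * f - c * e) 
        + 2 * g * d * (b * h - c * f) > 0" (is "?L \<longleftrightarrow> ?R")
proof -
  let ?det3 = "a * e * h + 2 * b * c * f - a * f\<^sup>2 - e * c\<^sup>2 - h * b\<^sup>2"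
  let ?det4 = "m * ?det3 - k\<^sup>2 * (a * e - b\<^sup>2) - g\<^sup>2 * (a * h - c\<^sup>2) - d\<^sup>2 * (e * h - f\<^sup>2)
        + 2 * k * g * (a * f - b * c) - 2 * k * d * (b * f - c * e) 
        + 2 * g * d * (b * h - c * f)"
  let ?l = "\<lambda>(y, z, t). b * y + c * z + d * t"
  let ?q = "\<lambda>(y, z, t). e * y\<^sup>2 + 2 * y * (f * z + g * t) + (h * z\<^sup>2 + 2 * z * (k * t) + m * t\<^sup>2)"
  have eq: "a * (e * y\<^sup>2 + 2 * y * (f * z + g * t) + (h * z\<^sup>2 + 2 * z * (k * t) + m * t\<^sup>2))
      - (b * y + c * z + d * t)\<^sup>2
      = (a * e - b\<^sup>2) * y\<^sup>2 + 2 * y * ((a * f - b * c) * z + (a * g - b * d) * t)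
       + ((a * h - c\<^sup>2) * z\<^sup>2 + 2 * z * ((a * k - c * d) * t) + (a * m - d\<^sup>2) * t\<^sup>2)" for y z t
    by (simp add: algebra_simps power2_eq_square)
  have det3: "(a * e - b\<^sup>2) * (a * h - c\<^sup>2) - (a * f - b * c)\<^sup>2 = a * ?det3"
    by (simp add: algebra_simps power2_eq_square)
  \<comment> \<open>The same determinant identity one size up: a 3 x 3 minor after elimination
    carries the factor \<open>a\<^sup>2\<close>.\<close>
  have det4: "(a * e - b\<^sup>2) * (a * h - c\<^sup>2) * (a * m - d\<^sup>2)
      + 2 * (a * f - b * c) * (a * g - b * d) * (a * k - c * d)
      - (a * e - b\<^sup>2) * (a * k - c * d)\<^sup>2 - (a * h - c\<^sup>2) * (a * g - b * d)\<^sup>2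
      - (a * m - d\<^sup>2) * (a * f - b * c)\<^sup>2 = a\<^sup>2 * ?det4"
    by (simp add: algebra_simps power2_eq_square)
  have "?L \<longleftrightarrow> (\<forall>x v. x \<noteq> 0 \<or> v \<noteq> 0 \<longrightarrow> a * x\<^sup>2 + 2 * x * ?l v + ?q v > 0)"
    by (auto simp: zero_prod_def)
  also have "\<dots> \<longleftrightarrow> a > 0 \<and> (\<forall>v. v \<noteq> 0 \<longrightarrow> a * ?q v - (?l v)\<^sup>2 > 0)"
    by (rule pos_def_schur) (simp_all add: zero_prod_def)
  also have "\<dots> \<longleftrightarrow> a > 0 \<and> (\<forall>y z t. y \<noteq> 0 \<or> z \<noteq> 0 \<or> t \<noteq> 0 \<longrightarrow>
      (a * e - b\<^sup>2) * y\<^sup>2 + 2 * y * ((a * f - b * c) * z + (a * g - b * d) * t)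
       + ((a * h - c\<^sup>2) * z\<^sup>2 + 2 * z * ((a * k - c * d) * t) + (a * m - d\<^sup>2) * t\<^sup>2) > 0)"
    by (auto simp: zero_prod_def simp flip: eq)
  also have "\<dots> \<longleftrightarrow> ?R"
    unfolding pos_def_form_3 det3 det4 by (auto simp: zero_less_mult_iff)
  finally show ?thesis .
qed


section \<open>The Bezoutian of a rotated real quartic\<close>

text \<open>The application has \<open>v = cnj w\<close> on the unit circle. Collecting the
  monomials in \<open>w\<close> and \<open>v\<close> by the difference of their exponents leaves
  powers of \<open>w * v\<close> times \<open>w^k - v^k\<close>, and each \<open>w^k - v^k\<close>
  is \<open>w - v\<close> times a polynomial in \<open>c\<close> and \<open>w * v\<close>.\<close>

lemma quartic_kernel:
  fixes a1 a2 a3 a4 w v x y :: complex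
  assumes "w * v = 1"
  defines "c \<equiv> w + v"
  shows "(a4 + a3 * w * x + a2 * w^2 * x^2 + a1 * w^3 * x^3 + w^4 * x^4)
       * (a4 + a3 * v * y + a2 * v^2 * y^2 + a1 * v^3 * y^3 + v^4 * y^4)
     - (a4 + a3 * v * x + a2 * v^2 * x^2 + a1 * v^3 * x^3 + v^4 * x^4)
       * (a4 + a3 * w * y + a2 * w^2 * y^2 + a1 * w^3 * y^3 + w^4 * y^4)
    = (w - v) * (x - y) * 
      (a3 * a4 + c * a2 * a4 * (x + y) + (c^2 - 1) * a1 * a4 * (x^2 + y^2)
        + (c^3 - 2 * c) * a4 * (x^3 + y^3)
        + ((c^2 - 1) * a1 * a4 + a2 * a3) * x * y
        + ((c^3 - 2 * c) * a4 + c * a1 * a3) * (x^2 * y + x * y^2)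
        + (c^2 - 1) * a3 * (x^3 * y + x * y^3)
        + ((c^2 - 1) * a3 + a1 * a2) * x^2 * y^2
        + c * a2 * (x^3 * y^2 + x^2 * y^3) + a1 * x^3 * y^3)"
proof -
  have "(a4 + a3 * w * x + a2 * w^2 * x^2 + a1 * w^3 * x^3 + w^4 * x^4)
       * (a4 + a3 * v * y + a2 * v^2 * y^2 + a1 * v^3 * y^3 + v^4 * y^4)
     - (a4 + a3 * v * x + a2 * v^2 * x^2 + a1 * v^3 * x^3 + v^4 * x^4)
       * (a4 + a3 * w * y + a2 * w^2 * y^2 + a1 * w^3 * y^3 + w^4 * y^4)
    = (w - v) * (a3 * a4 * (x - y) + a2 * a3 * (w * v) * (x^2 * y - x * y^2)
        + a1 * a2 * (w * v)^2 * (x^3 * y^2 - x^2 * y^3) + a1 * (w * v)^3 * (x^4 * y^3 - x^3 * y^4))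
      + (w^2 - v^2) * (a2 * a4 * (x^2 - y^2) + a1 * a3 * (w * v) * (x^3 * y - x * y^3)
        + a2 * (w * v)^2 * (x^4 * y^2 - x^2 * y^4))
      + (w^3 - v^3) * (a1 * a4 * (x^3 - y^3) + a3 * (w * v) * (x^4 * y - x * y^4))
      + (w^4 - v^4) * a4 * (x^4 - y^4)"
    by (simp add: algebra_simps eval_nat_numeral)
  also have "w^2 - v^2 = (w - v) * c"
    by (simp add: c_def algebra_simps eval_nat_numeral)
  also have "w^3 - v^3 = (w - v) * (c^2 - w * v)"
    by (simp add: c_def algebra_simps eval_nat_numeral)
  also have "w^4 - v^4 = (w - v) * (c^3 - 2 * c * (w * v))"
    by (simp add: c_def algebra_simps eval_nat_numeral)
  finally show ?thesis
    unfolding assms(1) by (simp add: algebra_simps eval_nat_numeral)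
qed

text \<open>Here \<open>c = 2 * cos \<phi>\<close>, so that \<open>c\<close>, \<open>c\<^sup>2 - 1\<close> and \<open>c ^ 3 - 2 * c\<close> are the quotients
  \<open>sin (k * \<phi>) / sin \<phi>\<close> for \<open>k = 2, 3, 4\<close>.\<close>

definition quartic_hermite_matrix :: "real \<Rightarrow> real \<Rightarrow> real \<Rightarrow> real \<Rightarrow> real \<Rightarrow> nat \<Rightarrow> nat \<Rightarrow> real" where
  "quartic_hermite_matrix a1 a2 a3 a4 c i j =
    [[a3 * a4, c * a2 * a4, (c^2 - 1) * a1 * a4, (c^3 - 2 * c) * a4],
     [c * a2 * a4, (c^2 - 1) * a1 * a4 + a2 * a3, (c^3 - 2 * c) * a4 + c * a1 * a3, (c^2 - 1) * a3],
     [(c^2 - 1) * a1 * a4, (c^3 - 2 * c) * a4 + c * a1 * a3, (c^2 - 1) * a3 + a1 * a2, c * a2],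
     [(c^3 - 2 * c) * a4, (c^2 - 1) * a3, c * a2, a1]] ! i ! j"

text \<open>The variables are taken in reverse order, so the minors grow from the corner entry
  \<open>a1\<close>. Entry \<open>(i, j)\<close> has the parity of \<open>i + j\<close> in
  \<open>c\<close>, so the minors are even in \<open>c\<close> and become polynomials in
  \<open>s\<close>, with \<open>c\<^sup>2 = 4 * s\<close>.\<close>

lemma quartic_hermite_matrix_pos_iff:
  assumes "c = 2 * u" and "s = u\<^sup>2"
  shows "(\<forall>v. (\<exists>i<4. v i \<noteq> 0) \<longrightarrow>
      (\<Sum>i<4. \<Sum>j<4. quartic_hermite_matrix a1 a2 a3 a4 c i j * v i * v j) > 0) \<longleftrightarrow>
      a1 > 0 \<and>
      (4*a1*a3 - 4*a2^2) * s + a1^2*a2 - a1*a3 > 0 \<and>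
      - (64*a1*a4^2 - 128*a2*a3*a4 + 64*a3^3) * s^3
      - (16*a1^2*a3*a4 + 16*a1*a2^2*a4 - 16*a1*a2*a3^2 - 64*a1*a4^2 + 96*a2*a3*a4 - 48*a3^3) * s^2
      + (4*a1^3*a2*a4 - 4*a1^3*a3^2 + 8*a1^2*a3*a4 + 4*a1*a2^2*a4 + 4*a1*a2*a3^2 - 4*a2^3*a3
         - 16*a1*a4^2 + 16*a2*a3*a4 - 12*a3^3) * s
      - a1^3*a2*a4 + a1^2*a2^2*a3 + a1^2*a3*a4 - 2*a1*a2*a3^2 + a3^3 > 0 \<and>
      a4 * (4096*a4^3 * s^6
        + (- 1024*a1*a3*a4^2 - 8192*a4^3) * s^5
        + (256*a1^2*a2*a4^2 + 1536*a1*a3*a4^2 - 512*a2^2*a4^2 + 256*a2*a3^2*a4 + 6144*a4^3) * s^4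
        + (- 64*a1^4*a4^2 - 64*a1^2*a2*a4^2 - 64*a1*a2^2*a3*a4 - 1024*a1*a3*a4^2
           + 512*a2^2*a4^2 - 64*a2*a3^2*a4 - 64*a3^4 - 2048*a4^3) * s^3
        + (48*a1^4*a4^2 + 16*a1^3*a2*a3*a4 - 64*a1^2*a2*a4^2 - 16*a1^2*a3^2*a4
           - 32*a1*a2^2*a3*a4 + 16*a1*a2*a3^3 + 16*a2^4*a4
           + 384*a1*a3*a4^2 - 128*a2^2*a4^2 - 64*a2*a3^2*a4 + 48*a3^4 + 256*a4^3) * s^2
        + (- 12*a1^4*a4^2 + 4*a1^3*a2*a3*a4 - 4*a1^3*a3^3 - 4*a1^2*a2^3*a4 + 16*a1^2*a2*a4^2
           + 8*a1^2*a3^2*a4 + 16*a1*a2^2*a3*a4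
           + 4*a1*a2*a3^3 - 4*a2^3*a3^2 - 64*a1*a3*a4^2 + 16*a2*a3^2*a4 - 12*a3^4) * s
        + a1^4*a4^2 - 2*a1^3*a2*a3*a4 + a1^2*a2^2*a3^2 + 2*a1^2*a3^2*a4
        - 2*a1*a2*a3^3 + a3^4) > 0"
    (is "?pd \<longleftrightarrow> ?m1 > 0 \<and> ?m2 > 0 \<and> ?m3 > 0 \<and> ?m4 > 0")
proof -
  let ?B = "quartic_hermite_matrix a1 a2 a3 a4 c"
  let ?form = "\<lambda>x y z t. ?B 3 3 * x\<^sup>2 + 2 * x * (?B 3 2 * y + ?B 3 1 * z + ?B 3 0 * t)
      + (?B 2 2 * y\<^sup>2 + 2 * y * (?B 2 1 * z + ?B 2 0 * t)
        + (?B 1 1 * z\<^sup>2 + 2 * z * (?B 1 0 * t) + ?B 0 0 * t\<^sup>2))"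
  have sum: "(\<Sum>i<4. \<Sum>j<4. ?B i j * v i * v j) = ?form (v 3) (v 2) (v 1) (v 0)"
    for v :: "nat \<Rightarrow> real"
    by (simp add: quartic_hermite_matrix_def eval_nat_numeral algebra_simps)
  have ex: "(\<exists>i<4. v i \<noteq> 0) \<longleftrightarrow> v 3 \<noteq> 0 \<or> v 2 \<noteq> 0 \<or> v 1 \<noteq> 0 \<or> v 0 \<noteq> 0"
    for v :: "nat \<Rightarrow> real"
    by (auto simp: eval_nat_numeral less_Suc_eq)
  have "?pd \<longleftrightarrow> (\<forall>x y z t. x \<noteq> 0 \<or> y \<noteq> 0 \<or> z \<noteq> 0 \<or> t \<noteq> 0 \<longrightarrow> ?form x y z t > 0)"
  proof
    assume pd: ?pd
    show "\<forall>x y z t. x \<noteq> 0 \<or> y \<noteq> 0 \<or> z \<noteq> 0 \<or> t \<noteq> 0 \<longrightarrow> ?form x y z t > 0"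
    proof (intro allI)
      fix x y z t :: real
      show "x \<noteq> 0 \<or> y \<noteq> 0 \<or> z \<noteq> 0 \<or> t \<noteq> 0 \<longrightarrow> ?form x y z t > 0"
        using pd[rule_format, of "(!) [t, z, y, x]"] unfolding sum ex
        by (simp add: numeral_2_eq_2 numeral_3_eq_3)
    qed
  qed (simp add: sum ex)
  also have "\<dots> \<longleftrightarrow> ?m1 > 0 \<and> ?m2 > 0 \<and> ?m3 > 0 \<and> ?m4 > 0"
  proof -
    have m: "?B 3 3 = a1"
      "a1 * ?B 2 2 - (?B 3 2)\<^sup>2 = ?m2"
      "a1 * ?B 2 2 * ?B 1 1 + 2 * ?B 3 2 * ?B 3 1 * ?B 2 1 - a1 * (?B 2 1)\<^sup>2
        - ?B 2 2 * (?B 3 1)\<^sup>2 - ?B 1 1 * (?B 3 2)\<^sup>2 = ?m3"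
      by (simp_all add: quartic_hermite_matrix_def assms eval_nat_numeral algebra_simps)
    \<comment> \<open>Row 0 of the matrix is divisible by \<open>a4\<close>; this is the factor in
      front of the last inequality.\<close>
    have m4: "?B 0 0 * ?m3 - (?B 1 0)\<^sup>2 * ?m2
        - (?B 2 0)\<^sup>2 * (a1 * ?B 1 1 - (?B 3 1)\<^sup>2) - (?B 3 0)\<^sup>2 * (?B 2 2 * ?B 1 1 - (?B 2 1)\<^sup>2)
        + 2 * ?B 1 0 * ?B 2 0 * (a1 * ?B 2 1 - ?B 3 2 * ?B 3 1)
        - 2 * ?B 1 0 * ?B 3 0 * (?B 3 2 * ?B 2 1 - ?B 3 1 * ?B 2 2)
        + 2 * ?B 2 0 * ?B 3 0 * (?B 3 2 * ?B 1 1 - ?B 3 1 * ?B 2 1) = ?m4"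
      by (simp add: quartic_hermite_matrix_def assms eval_nat_numeral algebra_simps)
    show ?thesis
      unfolding pos_def_form_4 m m4 ..
  qed
  finally show ?thesis .
qed

section \<open>From complex to real vectors\<close>

text \<open>The real part of \<open>v i * cnj (v j)\<close> is the product of the real parts plus
  that of the imaginary parts, so the form splits into its real values at \<open>Re\<close> and
  \<open>Im\<close> of the vector, at least one of which is positive.\<close>

lemma hermitian_pos_iff:
  fixes B :: "nat \<Rightarrow> nat \<Rightarrow> real"
  assumes "\<And>i j. i < n \<Longrightarrow> j < n \<Longrightarrow> B i j = B j i"
  shows "(\<forall>v :: nat \<Rightarrow> complex. (\<exists>i<n. v i \<noteq> 0) \<longrightarrow>
        Re (\<Sum>i<n. \<Sum>j<n. B i j * v i * cnj (v j)) > 0)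
    \<longleftrightarrow> (\<forall>v :: nat \<Rightarrow> real. (\<exists>i<n. v i \<noteq> 0) \<longrightarrow> (\<Sum>i<n. \<Sum>j<n. B i j * v i * v j) > 0)"
    (is "?C \<longleftrightarrow> ?R")
proof
  assume C: ?C
  show ?R
  proof (intro allI impI)
    fix v :: "nat \<Rightarrow> real"
    assume "\<exists>i<n. v i \<noteq> 0"
    then show "(\<Sum>i<n. \<Sum>j<n. B i j * v i * v j) > 0"
      using C[rule_format, of "\<lambda>i. of_real (v i)"] by simp
  qed
next
  let ?Q = "\<lambda>v :: nat \<Rightarrow> real. \<Sum>i<n. \<Sum>j<n. B i j * v i * v j"
  assume R: ?R
  have nonneg: "?Q v \<ge> 0" for v
  proof (cases "\<exists>i<n. v i \<noteq> 0")
    case True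
    then show ?thesis using R less_imp_le by blast
  next
    case False
    then show ?thesis by simp
  qed
  show ?C
  proof (intro allI impI)
    fix v :: "nat \<Rightarrow> complex"
    assume "\<exists>i<n. v i \<noteq> 0"
    then have "(\<exists>i<n. Re (v i) \<noteq> 0) \<or> (\<exists>i<n. Im (v i) \<noteq> 0)"
      by (auto simp: complex_eq_iff)
    then have "?Q (\<lambda>i. Re (v i)) + ?Q (\<lambda>i. Im (v i)) > 0"
      using R nonneg[of "\<lambda>i. Re (v i)"] nonneg[of "\<lambda>i. Im (v i)"]
      by (meson add_nonneg_pos add_pos_nonneg)
    moreover have "Re (\<Sum>i<n. \<Sum>j<n. B i j * v i * cnj (v j))
        = ?Q (\<lambda>i. Re (v i)) + ?Q (\<lambda>i. Im (v i))"
      by (simp add: sum.distrib algebra_simps)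
    ultimately show "Re (\<Sum>i<n. \<Sum>j<n. B i j * v i * cnj (v j)) > 0" by simp
  qed
qed

section \<open>The stability sector as two half planes\<close>

lemma Arg_gt_iff_half_planes:
  assumes "pi / 2 \<le> \<phi>" and "\<phi> < pi"
  shows "\<bar>Arg z\<bar> > \<phi> \<longleftrightarrow> Im (z * cis (- \<phi>)) > 0 \<and> Im (cnj z * cis (- \<phi>)) > 0"
proof (cases "z = 0")
  case True
  \<comment> \<open>With \<open>Arg 0 = 0\<close>, both sides are false at the origin.\<close>
  then show ?thesis using assms pi_gt_zero by (simp add: Arg_zero)
next
  case False
  define t where "t = Arg z"
  have t: "- pi < t" "t \<le> pi" by (simp_all add: t_def Arg_bounded mpi_less_Arg Arg_le_pi)
  have z: "z = cmod z * cis t"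
    unfolding t_def by (metis Arg_eq False cis_conv_exp)
  have "cnj z = cmod z * cis (- t)"
    by (subst z) (simp add: cis_cnj)
  then have "Im (z * cis (- \<phi>)) = cmod z * sin (t - \<phi>)"
    "Im (cnj z * cis (- \<phi>)) = cmod z * sin (- t - \<phi>)"
    by (subst z; simp add: sin_diff algebra_simps)+
  with False have "Im (z * cis (- \<phi>)) > 0 \<and> Im (cnj z * cis (- \<phi>)) > 0
      \<longleftrightarrow> sin (t - \<phi>) > 0 \<and> sin (- t - \<phi>) > 0"
    by (simp add: zero_less_mult_iff)
  \<comment> \<open>The sign change of \<open>t\<close> swaps the two sines, so nonnegative angles
    suffice. The second sine equals \<open>sin (u + \<phi> - pi)\<close>, whose argument is positive
    for \<open>u > \<phi>\<close> because \<open>\<phi> \<ge> pi / 2\<close>.\<close>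
  moreover have "u > \<phi> \<longleftrightarrow> sin (u - \<phi>) > 0 \<and> sin (- u - \<phi>) > 0" if u: "0 \<le> u" "u \<le> pi" for u
  proof
    assume "u > \<phi>"
    then have "sin (u - \<phi>) > 0"
      using assms u by (intro sin_gt_zero) auto
    moreover have "sin (u + \<phi> - pi) > 0"
      using \<open>u > \<phi>\<close> assms u by (intro sin_gt_zero) auto
    moreover have "sin (- u - \<phi>) = sin (u + \<phi> - pi)"
      by (simp add: sin_diff sin_add)
    ultimately show "sin (u - \<phi>) > 0 \<and> sin (- u - \<phi>) > 0" by simp
  next
    assume "sin (u - \<phi>) > 0 \<and> sin (- u - \<phi>) > 0"
    moreover have "sin (\<phi> - u) \<ge> 0" if "u \<le> \<phi>"
      using that assms u by (intro sin_ge_zero) auto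
    moreover have "sin (u - \<phi>) = - sin (\<phi> - u)"
      by (metis minus_diff_eq sin_minus)
    ultimately show "u > \<phi>" by fastforce
  qed
  from this[of t] this[of "- t"] t have "\<bar>t\<bar> > \<phi> \<longleftrightarrow> sin (t - \<phi>) > 0 \<and> sin (- t - \<phi>) > 0"
    using assms pi_gt_zero by (cases "t \<ge> 0") auto
  ultimately show ?thesis by (simp add: t_def)
qed

section \<open>Stability of the four-dimensional system\<close>

text \<open>The third inequality is \<open>source_ineq3\<close> with its two misprinted signs
  reversed.\<close>

theorem corollary3:
  fixes \<alpha> a1 a2 a3 a4 s :: real and A :: "real mat"
  assumes "1 \<le> \<alpha>" and "\<alpha> < 2"
    and "A \<in> carrier_mat 4 4"
    and "char_poly A = [:a4, a3, a2, a1, 1:]"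
    and "s = (cos (\<alpha> * pi / 2))\<^sup>2"
  shows "asymptotically_stable \<alpha> A \<longleftrightarrow>
      a1 > 0 \<and>
      (4*a1*a3 - 4*a2^2) * s + a1^2*a2 - a1*a3 > 0 \<and>
      - (64*a1*a4^2 - 128*a2*a3*a4 + 64*a3^3) * s^3
      - (16*a1^2*a3*a4 + 16*a1*a2^2*a4 - 16*a1*a2*a3^2 - 64*a1*a4^2 + 96*a2*a3*a4 - 48*a3^3) * s^2
      + (4*a1^3*a2*a4 - 4*a1^3*a3^2 + 8*a1^2*a3*a4 + 4*a1*a2^2*a4 + 4*a1*a2*a3^2 - 4*a2^3*a3
         - 16*a1*a4^2 + 16*a2*a3*a4 - 12*a3^3) * s
      - a1^3*a2*a4 + a1^2*a2^2*a3 + a1^2*a3*a4 - 2*a1*a2*a3^2 + a3^3 > 0 \<and>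
      a4 * (4096*a4^3 * s^6
        + (- 1024*a1*a3*a4^2 - 8192*a4^3) * s^5
        + (256*a1^2*a2*a4^2 + 1536*a1*a3*a4^2 - 512*a2^2*a4^2 + 256*a2*a3^2*a4 + 6144*a4^3) * s^4
        + (- 64*a1^4*a4^2 - 64*a1^2*a2*a4^2 - 64*a1*a2^2*a3*a4 - 1024*a1*a3*a4^2
           + 512*a2^2*a4^2 - 64*a2*a3^2*a4 - 64*a3^4 - 2048*a4^3) * s^3
        + (48*a1^4*a4^2 + 16*a1^3*a2*a3*a4 - 64*a1^2*a2*a4^2 - 16*a1^2*a3^2*a4
           - 32*a1*a2^2*a3*a4 + 16*a1*a2*a3^3 + 16*a2^4*a4
           + 384*a1*a3*a4^2 - 128*a2^2*a4^2 - 64*a2*a3^2*a4 + 48*a3^4 + 256*a4^3) * s^2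
        + (- 12*a1^4*a4^2 + 4*a1^3*a2*a3*a4 - 4*a1^3*a3^3 - 4*a1^2*a2^3*a4 + 16*a1^2*a2*a4^2
           + 8*a1^2*a3^2*a4 + 16*a1*a2^2*a3*a4
           + 4*a1*a2*a3^3 - 4*a2^3*a3^2 - 64*a1*a3*a4^2 + 16*a2*a3^2*a4 - 12*a3^4) * s
        + a1^4*a4^2 - 2*a1^3*a2*a3*a4 + a1^2*a2^2*a3^2 + 2*a1^2*a3^2*a4
        - 2*a1*a2*a3^3 + a3^4) > 0"
    (is "_ \<longleftrightarrow> ?minors")
proof -
  define \<phi> where "\<phi> = \<alpha> * pi / 2"
  have \<phi>: "pi / 2 \<le> \<phi>" "\<phi> < pi"
    using assms(1,2) by (simp_all add: \<phi>_def)
  then have sin: "sin \<phi> > 0"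
    using pi_gt_zero by (intro sin_gt_zero) linarith+
  define w where "w = cis \<phi>"
  have w: "w * cnj w = 1" "w \<noteq> 0" "w - cnj w = 2 * \<i> * sin \<phi>" "w + cnj w = 2 * cos \<phi>"
    by (simp_all add: w_def cis_mult cis_cnj cis_neq_zero) (simp_all add: complex_eq_iff)
  define F :: "complex poly" where "F = [:a4, a3, a2, a1, 1:]"
  define h :: "complex poly" where "h = [:a4, a3 * w, a2 * w^2, a1 * w^3, w^4:]"
  have h: "degree h = 4" "h \<noteq> 0" and h_rotates: "poly h p = poly F (w * p)" for p
    using w(2) by (simp_all add: h_def F_def algebra_simps eval_nat_numeral)
  have eig: "eigenvalue (map_mat complex_of_real A) z \<longleftrightarrow> poly F z = 0" for z
  proof -
    have "char_poly (map_mat complex_of_real A) = F"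
      using of_real_hom.char_poly_hom[OF assms(3), where ?'a = complex] assms(4) by (simp add: F_def)
    then show ?thesis
      using eigenvalue_root_char_poly[of "map_mat complex_of_real A" 4] assms(3) by simp
  qed
  have root_cnj: "poly F (cnj z) = 0" if "poly F z = 0" for z
  proof -
    have "poly F (cnj z) = cnj (poly F z)" by (simp add: F_def)
    with that show ?thesis by simp
  qed
  \<comment> \<open>The second half plane condition at \<open>z\<close> is the first one at the root
    \<open>cnj z\<close>.\<close>
  have "asymptotically_stable \<alpha> A \<longleftrightarrow> (\<forall>z. poly F z = 0 \<longrightarrow> Im (z * cis (- \<phi>)) > 0)"
    unfolding asymptotically_stable_def eig \<phi>_def[symmetric] Arg_gt_iff_half_planes[OF \<phi>]
    using root_cnj by blast
  also have "\<dots> \<longleftrightarrow> (\<forall>p. poly h p = 0 \<longrightarrow> Im p > 0)"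
  proof -
    have "w * cis (- \<phi>) = 1"
      by (simp add: w_def cis_mult)
    then have cancel: "w * p * cis (- \<phi>) = p" for p
      using mult.assoc[of p w "cis (- \<phi>)"] by (simp add: mult.commute)
    show ?thesis unfolding h_rotates
    proof safe
      fix p assume "\<forall>z. poly F z = 0 \<longrightarrow> Im (z * cis (- \<phi>)) > 0" "poly F (w * p) = 0"
      then show "Im p > 0" using cancel by metis
    next
      fix z assume "\<forall>p. poly F (w * p) = 0 \<longrightarrow> Im p > 0" "poly F z = 0"
      then show "Im (z * cis (- \<phi>)) > 0" using cancel[of z] by (metis mult.assoc)
    qed
  qed
  also have "\<dots> \<longleftrightarrow> (\<forall>v. (\<exists>i<4. v i \<noteq> 0) \<longrightarrow> Re (\<Sum>i<4. \<Sum>j<4.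
      of_real (sin \<phi> * quartic_hermite_matrix a1 a2 a3 a4 (2 * cos \<phi>) i j) * v i * cnj (v j)) > 0)"
  \<comment> \<open>In the kernel, \<open>w - cnj w = 2 * \<i> * sin \<phi>\<close> supplies the
    factor \<open>2 * \<i>\<close>; the remaining \<open>sin \<phi>\<close> goes into the matrix and
    is positive since \<open>\<phi>\<close> lies strictly between 0 and \<open>pi\<close>.\<close>
  proof (rule hermite_criterion[of h, unfolded h(1), OF _ h(2)])
    fix x y :: complex
    have "poly h z = a4 + a3 * w * z + a2 * w^2 * z^2 + a1 * w^3 * z^3 + w^4 * z^4"
      "cnj (poly h (cnj z)) = a4 + a3 * cnj w * z + a2 * cnj w^2 * z^2 + a1 * cnj w^3 * z^3
        + cnj w^4 * z^4" for z
      by (simp_all add: h_def algebra_simps eval_nat_numeral)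
    then show "poly h x * cnj (poly h (cnj y)) - cnj (poly h (cnj x)) * poly h y
        = 2 * \<i> * (x - y) * (\<Sum>i<4. \<Sum>j<4.
          of_real (sin \<phi> * quartic_hermite_matrix a1 a2 a3 a4 (2 * cos \<phi>) i j) * x ^ i * y ^ j)"
      by (simp only: quartic_kernel[OF w(1)] w(3,4))
         (simp add: quartic_hermite_matrix_def eval_nat_numeral algebra_simps)
  qed
  also have "\<dots> \<longleftrightarrow> (\<forall>v. (\<exists>i<4. v i \<noteq> 0) \<longrightarrow> (\<Sum>i<4. \<Sum>j<4.
      sin \<phi> * quartic_hermite_matrix a1 a2 a3 a4 (2 * cos \<phi>) i j * v i * v j) > 0)"
    by (rule hermitian_pos_iff)
       (auto simp: quartic_hermite_matrix_def eval_nat_numeral less_Suc_eq)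
  also have "\<dots> \<longleftrightarrow> (\<forall>v. (\<exists>i<4. v i \<noteq> 0) \<longrightarrow> (\<Sum>i<4. \<Sum>j<4.
      quartic_hermite_matrix a1 a2 a3 a4 (2 * cos \<phi>) i j * v i * v j) > 0)"
    using sin by (simp add: mult.assoc zero_less_mult_iff flip: sum_distrib_left)
  also have "\<dots> \<longleftrightarrow> ?minors"
    by (rule quartic_hermite_matrix_pos_iff[OF refl]) (simp add: assms(5) \<phi>_def)
  finally show ?thesis .
qed

end
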